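(* Let $\lambda>0$, $c>0$, and $p,q>0$ with $p+q\le 1$, and let $(X(t),Y(t))$ be the planar random motion defined in the context. Let $\partial S_{ct}$ be the boundary of the square $S_{ct}=\{(x,y)\in\mathbb{R}^2: |x+y|\le ct,\ |x-y|\le ct\}$. Then for every $t>0$ $$\mathbb{P}\big((X(t),Y(t))\in\partial S_{ct}\big)=e^{-\lambda t}\left\{e^{\lambda t\sqrt{pq}}\left(1+\frac{p+q}{2\sqrt{pq}}\right)+e^{-\lambda t\sqrt{pq}}\left(1-\frac{p+q}{2\sqrt{pq}}\right)-1\right\}.$$
   Context: Model. Let $d_j=(\cos(\pi j/2),\sin(\pi j/2))$, with index $j$ taken modulo 4. Let $N(t)$ be a homogeneous Poisson process of rate $\lambda$. The direction process $D(t)$ takes values in $\{d_0,d_1,d_2,d_3\}$; $D(0)$ is uniformly distributed and independent of $N$; $D$ is constant between Poisson events; at each Poisson event, independently of everything else, $D$ jumps from its current value $d_j$ to $d_{j+1}$ with probability $p$ (counterclockwise turn), to $d_{j-1}$ with probability $q$ (clockwise turn), and to $d_{j+2}$ with probability $1-p-q$ (reflection). The motion starts at the origin and has speed $c$: $(X(t),Y(t))=c\int_0^t D(\tau)\,d\tau$. *)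

theory Defs
  imports "HOL-Probability.Probability"
begin

text \<open>
  Homogeneous Poisson process of a given rate. The path properties are required for every
  outcome, not just almost surely, so that events depending on whole paths are measurable
  without completing \<open>M\<close>. Since paths are nondecreasing, the truncated subtraction on
  \<^typ>\<open>nat\<close> gives the actual increments.
\<close>

locale poisson_process = prob_space M for M :: "'a measure" +
  fixes rate :: real and N :: "real \<Rightarrow> 'a \<Rightarrow> nat"
  assumes rate_pos: "0 < rate"
    and N_measurable: "0 \<le> t \<Longrightarrow> N t \<in> measurable M (count_space UNIV)"
    and N_zero: "\<omega> \<in> space M \<Longrightarrow> N 0 \<omega> = 0"
    and N_mono: "\<omega> \<in> space M \<Longrightarrow> 0 \<le> s \<Longrightarrow> s \<le> t \<Longrightarrow> N s \<omega> \<le> N t \<omega>"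
    and N_right_continuous:
      "\<omega> \<in> space M \<Longrightarrow> 0 \<le> t \<Longrightarrow> continuous (at_right t) (\<lambda>s. N s \<omega>)"
    and N_increments_indep:
      "0 \<le> \<tau> 0 \<Longrightarrow> mono \<tau> \<Longrightarrow>
        indep_vars (\<lambda>_. count_space UNIV)
          (\<lambda>i \<omega>. N (\<tau> (Suc i)) \<omega> - N (\<tau> i) \<omega>) {..<n::nat}"
    and N_increments_poisson:
      "0 \<le> s \<Longrightarrow> s < t \<Longrightarrow>
        distr M (count_space UNIV) (\<lambda>\<omega>. N t \<omega> - N s \<omega>)
          = measure_pmf (poisson_pmf (rate * (t - s)))"

text \<open>
  Indices range over all integers; they are implicitly taken modulo 4, because \<open>dir\<close> has
  period 4.
\<close>

definition dir :: "int \<Rightarrow> real \<times> real" where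
  "dir j = (cos (pi * of_int j / 2), sin (pi * of_int j / 2))"

text \<open>
  \<open>J0\<close> is the index of the initial direction and \<open>turn k\<close> is the increment of the index at
  the \<open>(k+1)\<close>-st Poisson event, so that after \<open>n\<close> events the index is
  \<open>J0 + (\<Sum>k<n. turn k)\<close>.
\<close>

definition direction ::
  "(real \<Rightarrow> 'a \<Rightarrow> nat) \<Rightarrow> ('a \<Rightarrow> int) \<Rightarrow> (nat \<Rightarrow> 'a \<Rightarrow> int) \<Rightarrow> real \<Rightarrow> 'a \<Rightarrow> real \<times> real" where
  "direction N J0 turn t \<omega> = dir (J0 \<omega> + (\<Sum>k<N t \<omega>. turn k \<omega>))"

definition position ::
  "real \<Rightarrow> (real \<Rightarrow> 'a \<Rightarrow> nat) \<Rightarrow> ('a \<Rightarrow> int) \<Rightarrow> (nat \<Rightarrow> 'a \<Rightarrow> int) \<Rightarrow> real \<Rightarrow> 'a \<Rightarrow> real \<times> real"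
  where
  "position c N J0 turn t \<omega> = c *\<^sub>R integral {0..t} (\<lambda>\<tau>. direction N J0 turn \<tau> \<omega>)"

text \<open>
  \<open>turns_indep\<close> states that \<open>J0, turn 0, turn 1, \<dots>\<close> are mutually independent, and
  \<open>turns_indep_N\<close> that this whole sequence is independent of the whole process \<open>N\<close>
  (independence of the generated sigma-algebras).
\<close>

locale planar_motion = poisson_process M rate N
  for M :: "'a measure" and rate :: real and N :: "real \<Rightarrow> 'a \<Rightarrow> nat" +
  fixes p q :: real and J0 :: "'a \<Rightarrow> int" and turn :: "nat \<Rightarrow> 'a \<Rightarrow> int"
  assumes J0_uniform:
      "distr M (count_space UNIV) J0 = measure_pmf (pmf_of_set {0..3})"
    and turn_counterclockwise: "prob {\<omega> \<in> space M. turn k \<omega> = 1} = p"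
    and turn_clockwise: "prob {\<omega> \<in> space M. turn k \<omega> = -1} = q"
    and turn_reflection: "prob {\<omega> \<in> space M. turn k \<omega> = 2} = 1 - p - q"
    and turns_indep: "indep_vars (\<lambda>_. count_space UNIV) (case_nat J0 turn) UNIV"
    and turns_indep_N:
      "indep_set
        (sigma_sets (space M) {N t -` A \<inter> space M | t A. 0 \<le> t})
        (sigma_sets (space M) {case_nat J0 turn k -` A \<inter> space M | k A. True})"

definition square :: "real \<Rightarrow> (real \<times> real) set" where
  "square r = {(x, y). \<bar>x + y\<bar> \<le> r \<and> \<bar>x - y\<bar> \<le> r}"

end

(*
  A motion of speed c reaches the boundary of the square at time t exactly when x + y or x - y
  runs at its extremal rate c the whole time, i.e. when all directions used on [0, t) lie in one
  pair {d_a, d_(a+1)}. Almost surely every heading taken up to time t is held for a positive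
  time, so this means that the turns before time t alternate between +1 and -1. As the turns are
  independent of N, the n turns alternate with probability (pq)^m + (pq)^m if n = 2m > 0 and
  (p + q) (pq)^m if n = 2m + 1; averaging over the Poisson distribution of n gives the cosh and
  sinh series in lambda t sqrt(pq).
*)
theory Submission
  imports Defs
begin

section \<open>The square and the four directions\<close>

text \<open>The square is an intersection of four closed half-planes. Interiors commute with finite
  intersections, so its interior is given by the four strict inequalities.\<close>

lemma frontier_square:
  "frontier (square r) = {(x, y) \<in> square r. \<bar>x + y\<bar> = r \<or> \<bar>x - y\<bar> = r}"
proof -
  have eq: "square r = {z. (1, 1) \<bullet> z \<le> r} \<inter> {z. (- 1, - 1) \<bullet> z \<le> r}
      \<inter> ({z. (1, - 1) \<bullet> z \<le> r} \<inter> {z. (- 1, 1) \<bullet> z \<le> r})"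
    by (auto simp: square_def)
  have nz: "(1, 1) \<noteq> (0 :: real \<times> real)" "(- 1, - 1) \<noteq> (0 :: real \<times> real)"
    "(1, - 1) \<noteq> (0 :: real \<times> real)" "(- 1, 1) \<noteq> (0 :: real \<times> real)"
    by (simp_all add: prod_eq_iff)
  have "closed (square r)"
    unfolding eq by (intro closed_Int closed_halfspace_le)
  have "interior (square r) = {z. (1, 1) \<bullet> z < r} \<inter> {z. (- 1, - 1) \<bullet> z < r}
      \<inter> ({z. (1, - 1) \<bullet> z < r} \<inter> {z. (- 1, 1) \<bullet> z < r})"
    unfolding eq interior_Int
    by (simp only: interior_halfspace_le[OF nz(1)] interior_halfspace_le[OF nz(2)]
      interior_halfspace_le[OF nz(3)] interior_halfspace_le[OF nz(4)])
  also have "\<dots> = {(x, y). \<bar>x + y\<bar> < r \<and> \<bar>x - y\<bar> < r}"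
    by (auto simp: abs_less_iff)
  finally have "frontier (square r) = square r - {(x, y). \<bar>x + y\<bar> < r \<and> \<bar>x - y\<bar> < r}"
    using \<open>closed (square r)\<close> by (simp add: frontier_def)
  also have "\<dots> = {(x, y) \<in> square r. \<bar>x + y\<bar> = r \<or> \<bar>x - y\<bar> = r}"
    unfolding square_def by (auto simp: not_less)
  finally show ?thesis .
qed

text \<open>The rates of x + y and x - y are signs, each singling out a pair of adjacent directions.
  The shift by 3 puts both in the form \<open>(j - a) mod 4 \<in> {0, 1}\<close>, which selects d_a
  and d_(a+1), with a = 0 and a = 3.\<close>

lemma dir_sum: "fst (dir j) + snd (dir j) = (if j mod 4 \<in> {0, 1} then 1 else - 1)"
  and dir_diff: "fst (dir j) - snd (dir j) = (if (j - 3) mod 4 \<in> {0, 1} then 1 else - 1)"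
proof -
  define m r where "m = j div 4" and "r = j mod 4"
  have j: "j = 4 * m + r" by (simp add: m_def r_def)
  have "r \<in> {0, 1, 2, 3}" unfolding r_def by auto
  moreover have a: "pi * real_of_int j / 2 = pi * real_of_int r / 2 + 2 * pi * real_of_int m"
    unfolding j by (simp add: field_simps)
  have "dir j = dir r"
    unfolding dir_def a by (simp add: cos_add sin_add)
  moreover have "cos (pi * 3 / 2) = 0" "sin (pi * 3 / 2) = - 1"
    using cos_3over2_pi sin_3over2_pi by (simp_all add: field_simps)
  moreover have "j mod 4 = r" "(j - 3) mod 4 = (r - 3) mod 4"
    by (simp_all add: r_def mod_diff_left_eq)
  ultimately show "fst (dir j) + snd (dir j) = (if j mod 4 \<in> {0, 1} then 1 else - 1)"
    "fst (dir j) - snd (dir j) = (if (j - 3) mod 4 \<in> {0, 1} then 1 else - 1)"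
    by (auto simp: dir_def)
qed

section \<open>Integrals along monotone counting paths\<close>

text \<open>Level sets of a monotone function are intervals, and only values up to
  \<open>n t\<close> occur on \<open>{0..t}\<close>, so the integrand is a finite sum of multiples
  of interval indicators.\<close>

lemma integrable_on_comp_mono:
  fixes n :: "real \<Rightarrow> nat" and g :: "nat \<Rightarrow> 'b::euclidean_space"
  assumes "mono_on {0..t} n"
  shows "(\<lambda>s. g (n s)) integrable_on {0..t}"
proof -
  define S where "S k = {s \<in> {0..t}. n s = k}" for k
  have "is_interval (S k)" for k
    unfolding is_interval_1
  proof (intro ballI allI impI)
    fix a b x assume *: "a \<in> S k" "b \<in> S k" "a \<le> x \<and> x \<le> b"
    then have "n a \<le> n x" "n x \<le> n b"
      using mono_onD[OF assms, of a x] mono_onD[OF assms, of x b] by (simp_all add: S_def)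
    with * show "x \<in> S k" by (simp add: S_def)
  qed
  then have "S k \<in> lmeasurable" for k
    by (intro measurable_convex is_interval_convex)
      (auto simp: S_def intro: bounded_subset[of "{0..t}"])
  then have "(\<lambda>s. if s \<in> S k then g k else 0) integrable_on {0..t}" for k
    using integrable_restrict_Int[of "S k" "\<lambda>_. g k" "{0..t}"] integrable_on_const[of "S k" "g k"]
    by (simp add: S_def Int_def conj_commute conj_left_commute)
  then have "(\<lambda>s. \<Sum>k\<le>n t. if s \<in> S k then g k else 0) integrable_on {0..t}"
    by (intro integrable_sum) auto
  moreover have "(\<Sum>k\<le>n t. if s \<in> S k then g k else 0) = g (n s)" if "s \<in> {0..t}" for s
  proof -
    have "n s \<le> n t" using that by (intro mono_onD[OF assms]) auto
    then show ?thesis using that by (simp add: S_def)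
  qed
  ultimately show ?thesis by (rule integrable_eq)
qed

text \<open>A value below 1 at s persists on an interval to the right of s and so costs a positive
  amount of the integral. The endpoint t is left out because a single point carries no
  weight.\<close>

lemma integral_eq_length_iff:
  fixes f :: "real \<Rightarrow> real"
  assumes int: "f integrable_on {0..t}" and le: "\<And>s. s \<in> {0..t} \<Longrightarrow> f s \<le> 1"
    and rc: "\<And>s. s \<in> {0..<t} \<Longrightarrow> eventually (\<lambda>r. f r = f s) (at_right s)" and "0 < t"
  shows "integral {0..t} f = t \<longleftrightarrow> (\<forall>s\<in>{0..<t}. f s = 1)"
proof
  assume eq: "integral {0..t} f = t"
  show "\<forall>s\<in>{0..<t}. f s = 1"
  proof (rule ballI, rule ccontr)
    fix s assume s: "s \<in> {0..<t}" and "f s \<noteq> 1"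
    with le[of s] have less: "f s < 1" by auto
    obtain b where b: "b > s" "\<And>r. s < r \<Longrightarrow> r < b \<Longrightarrow> f r = f s"
      using rc[OF s] by (auto simp: eventually_at_right_field)
    \<comment> \<open>The midpoint of s and \<open>min b t\<close> keeps \<open>{s..e}\<close>
      inside both the stretch where f is constant and \<open>{0..<t}\<close>.\<close>
    define e where "e = (min b t + s) / 2"
    have e: "s < e" "e < b" "e < t" using b s by (auto simp: e_def)
    have int': "(\<lambda>r. 1 - f r) integrable_on {0..t}" by (intro integrable_diff int) auto
    have sub: "(\<lambda>r. 1 - f r) integrable_on {s..e}"
      using s e by (intro integrable_on_subinterval[OF int']) auto
    have "(e - s) * (1 - f s) = integral {s..e} (\<lambda>r. 1 - f s)" using e by simp
    also have "\<dots> = integral {s..e} (\<lambda>r. 1 - f r)"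
    proof (rule integral_cong)
      fix r assume "r \<in> {s..e}"
      then have "r = s \<or> s < r \<and> r < b" using e by auto
      then show "1 - f s = 1 - f r" using b(2)[of r] by auto
    qed
    also have "\<dots> \<le> integral {0..t} (\<lambda>r. 1 - f r)"
      using s e le sub int' by (intro integral_subset_le) auto
    also have "\<dots> = 0" using eq \<open>0 < t\<close> int by (subst integral_diff) auto
    finally show False using e less by (simp add: mult_le_0_iff)
  qed
next
  assume *: "\<forall>s\<in>{0..<t}. f s = 1"
  have "integral {0..t} f = integral {0..t} (\<lambda>_. 1)"
    by (rule integral_spike[of "{t}"]) (use * in auto)
  then show "integral {0..t} f = t" using \<open>0 < t\<close> by simp
qed

text \<open>The direction index as a function of the number of events instead of time, so that time
  enters only through \<open>N s\<close>.\<close>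

definition heading :: "('a \<Rightarrow> int) \<Rightarrow> (nat \<Rightarrow> 'a \<Rightarrow> int) \<Rightarrow> nat \<Rightarrow> 'a \<Rightarrow> int" where
  "heading J0 turn n \<omega> = J0 \<omega> + (\<Sum>k<n. turn k \<omega>)"

text \<open>Up to the factor c, the integrals \<open>G a\<close> for the four residues of a mod 4
  are x + y, x - y and their negatives. Each is at most t, so the boundary is reached exactly when
  one of them equals t, that is, when its integrand is 1 throughout \<open>{0..<t}\<close>.\<close>

lemma position_mem_frontier_iff:
  assumes "0 < c" "0 < t" and mono: "mono_on {0..t} (\<lambda>s. N s \<omega>)"
    and rc: "\<And>s. s \<in> {0..<t} \<Longrightarrow> eventually (\<lambda>r. N r \<omega> = N s \<omega>) (at_right s)"
  shows "position c N J0 turn t \<omega> \<in> frontier (square (c * t)) \<longleftrightarrow>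
    (\<exists>a. \<forall>s\<in>{0..<t}. (heading J0 turn (N s \<omega>) \<omega> - a) mod 4 \<in> {0, 1})"
proof -
  define g :: "int \<Rightarrow> nat \<Rightarrow> real" where
    "g a n = (if (heading J0 turn n \<omega> - a) mod 4 \<in> {0, 1} then 1 else - 1)" for a n
  define G where "G a = integral {0..t} (\<lambda>s. g a (N s \<omega>))" for a
  define I where "I = integral {0..t} (\<lambda>s. dir (heading J0 turn (N s \<omega>) \<omega>))"
  have int: "(\<lambda>s. f (N s \<omega>)) integrable_on {0..t}" for f :: "nat \<Rightarrow> 'z::euclidean_space"
    by (rule integrable_on_comp_mono[OF mono])
  have pos: "position c N J0 turn t \<omega> = c *\<^sub>R I"
    by (simp add: position_def direction_def I_def heading_def)
  have lin: "h I = integral {0..t} (\<lambda>s. h (dir (heading J0 turn (N s \<omega>) \<omega>)))"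
    if "bounded_linear h" for h :: "real \<times> real \<Rightarrow> real"
    using integral_linear[OF int[of "\<lambda>n. dir (heading J0 turn n \<omega>)"] that]
    by (simp add: I_def o_def)
  have sum: "fst I + snd I = G 0"
    using lin[of "\<lambda>z. fst z + snd z"]
    by (simp add: G_def g_def dir_sum bounded_linear_add bounded_linear_fst bounded_linear_snd)
  have diff: "fst I - snd I = G 3"
    using lin[of "\<lambda>z. fst z - snd z"]
    by (simp add: G_def g_def dir_diff bounded_linear_sub bounded_linear_fst bounded_linear_snd)
  have le: "G a \<le> t" for a
  proof -
    have "G a \<le> integral {0..t} (\<lambda>_. 1)"
      unfolding G_def by (intro integral_le int[of "g a"]) (auto simp: g_def)
    then show ?thesis using \<open>0 < t\<close> by simp
  qed
  \<comment> \<open>The pairs belonging to a and a + 2 are complementary. The resulting sign change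
    splits each absolute value below into two one-sided conditions.\<close>
  have "g (a + 2) n = - g a n" for a n
  proof -
    define x where "x = heading J0 turn n \<omega> - a"
    have "x mod 4 \<in> {0, 1} \<longleftrightarrow> (x - 2) mod 4 \<notin> {0, 1}"
      unfolding insert_iff empty_iff by presburger
    then show ?thesis by (simp add: g_def x_def algebra_simps)
  qed
  then have neg: "G (a + 2) = - G a" for a
    by (simp add: G_def)
  have eq: "G a = t \<longleftrightarrow> (\<forall>s\<in>{0..<t}. (heading J0 turn (N s \<omega>) \<omega> - a) mod 4 \<in> {0, 1})" for a
  proof -
    have "G a = t \<longleftrightarrow> (\<forall>s\<in>{0..<t}. g a (N s \<omega>) = 1)"
      unfolding G_def
    proof (rule integral_eq_length_iff)
      show "(\<lambda>s. g a (N s \<omega>)) integrable_on {0..t}" by (rule int)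
      show "eventually (\<lambda>r. g a (N r \<omega>) = g a (N s \<omega>)) (at_right s)" if "s \<in> {0..<t}" for s
        using rc[OF that] by eventually_elim simp
    qed (auto simp: g_def \<open>0 < t\<close>)
    then show ?thesis by (auto simp: g_def split: if_splits)
  qed
  have "position c N J0 turn t \<omega> \<in> frontier (square (c * t)) \<longleftrightarrow>
      \<bar>c * G 0\<bar> \<le> c * t \<and> \<bar>c * G 3\<bar> \<le> c * t \<and> (\<bar>c * G 0\<bar> = c * t \<or> \<bar>c * G 3\<bar> = c * t)"
    unfolding pos frontier_square sum[symmetric] diff[symmetric]
    by (cases I) (simp add: square_def algebra_simps)
  also have "\<dots> \<longleftrightarrow> \<bar>G 0\<bar> \<le> t \<and> \<bar>G 3\<bar> \<le> t \<and> (\<bar>G 0\<bar> = t \<or> \<bar>G 3\<bar> = t)"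
    using \<open>0 < c\<close> by (simp add: abs_mult)
  also have "\<dots> \<longleftrightarrow> G 0 = t \<or> G 2 = t \<or> G 3 = t \<or> G 1 = t"
    using le[of 0] le[of 1] le[of 2] le[of 3] neg[of 0] neg[of 1] by auto
  also have "\<dots> \<longleftrightarrow> (\<exists>a. G a = t)"
  proof
    assume "\<exists>a. G a = t"
    then obtain a where "G a = t" ..
    moreover have "g (a mod 4) = g a" by (simp add: g_def mod_diff_right_eq fun_eq_iff)
    ultimately have "G (a mod 4) = t" by (simp add: G_def)
    moreover have "a mod 4 \<in> {0, 1, 2, 3}" by auto
    ultimately show "G 0 = t \<or> G 2 = t \<or> G 3 = t \<or> G 1 = t" by auto
  qed auto
  finally show ?thesis by (simp add: eq)
qed

section \<open>Alternation of the turns\<close>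

text \<open>Let \<open>x k\<close> be the place, 0 or 1, of the k-th heading within the pair. From
  place 0 only the turn +1 stays in the pair, from place 1 only -1, and no turn is 0, so the places
  and the turns both alternate. Conversely, the partial sums of alternating turns take only the
  values 0 and \<open>\<sigma>\<close>.\<close>

lemma two_directions_iff_alternating:
  fixes j :: int and T :: "nat \<Rightarrow> int"
  assumes T: "\<And>k. T k \<in> {1, - 1, 2}"
  shows "(\<exists>a. \<forall>k\<le>n. (j + sum T {..<k} - a) mod 4 \<in> {0, 1}) \<longleftrightarrow>
    (\<exists>\<sigma>\<in>{1, - 1}. \<forall>k<n. T k = \<sigma> * (- 1) ^ k)"
proof
  assume "\<exists>a. \<forall>k\<le>n. (j + sum T {..<k} - a) mod 4 \<in> {0, 1}"
  then obtain a where a: "\<And>k. k \<le> n \<Longrightarrow> (j + sum T {..<k} - a) mod 4 \<in> {0, 1}" by blast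
  define x where "x k = (j + sum T {..<k} - a) mod 4" for k
  define \<sigma> :: int where "\<sigma> = (if x 0 = 0 then 1 else - 1)"
  have step: "T k = (if x k = 0 then 1 else - 1) \<and> x (Suc k) = 1 - x k" if "k < n" for k
  proof -
    have "x (Suc k) = (j + sum T {..<k} - a + T k) mod 4"
      by (simp add: x_def algebra_simps)
    also have "\<dots> = (x k + T k) mod 4"
      unfolding x_def by (rule mod_add_left_eq[symmetric])
    finally have "x (Suc k) = (x k + T k) mod 4" .
    moreover have "x k \<in> {0, 1}" "x (Suc k) \<in> {0, 1}"
      using a[of k] a[of "Suc k"] that by (auto simp: x_def)
    ultimately show ?thesis using T[of k] by auto
  qed
  have x0: "x 0 = 0 \<or> x 0 = 1" using a[of 0] by (simp add: x_def)
  have x: "x k = (if even k \<longleftrightarrow> x 0 = 0 then 0 else 1)" if "k \<le> n" for k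
    using that
  proof (induction k)
    case 0 show ?case using x0 by auto
  next
    case (Suc k) then show ?case using step[of k] by auto
  qed
  have "T k = \<sigma> * (- 1) ^ k" if "k < n" for k
  proof -
    have "x k = (if even k \<longleftrightarrow> x 0 = 0 then 0 else 1)" by (intro x less_imp_le that)
    then show ?thesis using step[OF that] by (cases "even k"; cases "x 0 = 0") (simp_all add: \<sigma>_def)
  qed
  then show "\<exists>\<sigma>\<in>{1, - 1}. \<forall>k<n. T k = \<sigma> * (- 1) ^ k"
    by (intro bexI[of _ \<sigma>] allI impI) (simp_all add: \<sigma>_def)
next
  assume "\<exists>\<sigma>\<in>{1, - 1}. \<forall>k<n. T k = \<sigma> * (- 1) ^ k"
  then obtain \<sigma> where \<sigma>: "\<sigma> \<in> {1, - 1}" and alt: "\<And>k. k < n \<Longrightarrow> T k = \<sigma> * (- 1) ^ k" by blast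
  have "sum T {..<k} = (if even k then 0 else \<sigma>)" if "k \<le> n" for k
    using that by (induction k) (auto simp: alt)
  \<comment> \<open>For \<open>\<sigma> = 1\<close> the headings are j and j + 1, for
    \<open>\<sigma> = - 1\<close> they are j and j - 1; a is the smaller of the two.\<close>
  then have "\<forall>k\<le>n. (j + sum T {..<k} - (if \<sigma> = 1 then j else j - 1)) mod 4 \<in> {0, 1}"
    using \<sigma> by auto
  then show "\<exists>a. \<forall>k\<le>n. (j + sum T {..<k} - a) mod 4 \<in> {0, 1}" by blast
qed

section \<open>Closed forms of the weights and of their Poisson average\<close>

text \<open>With r = \<open>sqrt (p * q)\<close>, the left side is 2 r^n for even n and (p + q) r^(n
  - 1) for odd n. Combining the powers of r and -r covers both parities in one formula, so that
  exponential series arise directly.\<close>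

lemma prod_alternating_eq:
  fixes p q :: real
  assumes "0 < p" "0 < q"
  shows "(\<Prod>k<n. if even k then p else q) + (\<Prod>k<n. if even k then q else p)
    = sqrt (p * q) ^ n * (1 + (p + q) / (2 * sqrt (p * q)))
      + (- sqrt (p * q)) ^ n * (1 - (p + q) / (2 * sqrt (p * q)))"
proof -
  have even: "(\<Prod>k<2 * m. if even k then x else y) = (x * y) ^ m" for m and x y :: real
    by (induction m) (auto simp: algebra_simps)
  define r where "r = sqrt (p * q)"
  have r: "r > 0" "p * q = r ^ 2" using assms by (simp_all add: r_def)
  have qp: "q * p = r ^ 2" using r by (simp add: mult.commute)
  show ?thesis unfolding r_def[symmetric]
  proof (cases "even n")
    case True
    then obtain m where n: "n = 2 * m" by (auto elim: evenE)
    show "(\<Prod>k<n. if even k then p else q) + (\<Prod>k<n. if even k then q else p)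
      = r ^ n * (1 + (p + q) / (2 * r)) + (- r) ^ n * (1 - (p + q) / (2 * r))"
      unfolding n even r(2) qp by (simp add: power_mult[symmetric] algebra_simps)
  next
    case False
    then obtain m where n: "n = Suc (2 * m)" by (auto elim: oddE)
    show "(\<Prod>k<n. if even k then p else q) + (\<Prod>k<n. if even k then q else p)
      = r ^ n * (1 + (p + q) / (2 * r)) + (- r) ^ n * (1 - (p + q) / (2 * r))"
      unfolding n prod.lessThan_Suc even r(2) qp using r(1)
      by (simp add: power_mult[symmetric] field_simps)
  qed
qed

text \<open>The two powers give exponential series at \<open>\<mu> * r\<close> and
  \<open>- \<mu> * r\<close>. The correction at n = 0 is a single term and produces the final
  -1.\<close>

lemma alternating_poisson_sums:
  fixes p q \<mu> :: real
  assumes "0 < p" "0 < q" "0 < \<mu>"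
  shows "(\<lambda>n. (\<mu> ^ n / fact n * exp (- \<mu>)) *
      ((\<Prod>k<n. if even k then p else q) + (\<Prod>k<n. if even k then q else p) - (if n = 0 then 1 else 0)))
    sums (exp (- \<mu>) * (exp (\<mu> * sqrt (p * q)) * (1 + (p + q) / (2 * sqrt (p * q)))
      + exp (- \<mu> * sqrt (p * q)) * (1 - (p + q) / (2 * sqrt (p * q))) - 1))"
proof -
  define r b where "r = sqrt (p * q)" and "b = (p + q) / (2 * r)"
  have e: "(\<lambda>n. x ^ n / fact n) sums exp x" for x :: real
    using exp_converges[of x] by (simp add: field_simps)
  have d: "(\<lambda>n. if n = 0 then 1 else 0 :: real) sums 1"
    using sums_If_finite[of "\<lambda>n. n = 0" "\<lambda>_. 1 :: real"] by simp
  have "(\<lambda>n. exp (- \<mu>) * ((\<mu> * r) ^ n / fact n * (1 + b) + (- \<mu> * r) ^ n / fact n * (1 - b)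
      - (if n = 0 then 1 else 0)))
    sums (exp (- \<mu>) * (exp (\<mu> * r) * (1 + b) + exp (- \<mu> * r) * (1 - b) - 1))"
    by (intro sums_mult sums_add sums_diff sums_mult2 e d)
  moreover have "(\<mu> * r) ^ n / fact n * (1 + b) + (- \<mu> * r) ^ n / fact n * (1 - b)
      - (if n = 0 then 1 else 0)
    = (\<mu> ^ n / fact n) * (r ^ n * (1 + b) + (- r) ^ n * (1 - b) - (if n = 0 then 1 else 0))" for n
  proof -
    have "(- \<mu> * r) ^ n = \<mu> ^ n * (- r) ^ n" by (simp flip: power_mult_distrib)
    then show ?thesis by (simp only:) (simp add: power_mult_distrib field_simps)
  qed
  ultimately show ?thesis
    unfolding prod_alternating_eq[OF assms(1,2)] r_def[symmetric] b_def[symmetric]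
    by (simp add: mult_ac)
qed

section \<open>Poisson paths skip no value\<close>

text \<open>A discrete intermediate value theorem: upward steps of size at most one cannot jump over
  k.\<close>

lemma grid_values_attained:
  fixes f :: "nat \<Rightarrow> nat"
  assumes "f 0 = 0" "\<And>i. i < m \<Longrightarrow> f (Suc i) \<le> Suc (f i)" "k \<le> f m"
  shows "\<exists>i\<le>m. f i = k"
  using assms(2,3)
proof (induction m)
  case 0 then show ?case using assms(1) by auto
next
  case (Suc m)
  show ?case
  proof (cases "k = f (Suc m)")
    case False
    then have "k \<le> f m" using Suc.prems(1)[of m] Suc.prems(2) by auto
    then show ?thesis using Suc by (metis le_SucI less_SucI)
  qed auto
qed

context poisson_process
begin

lemma increment_measurable:
  "0 \<le> s \<Longrightarrow> 0 \<le> t \<Longrightarrow> (\<lambda>\<omega>. N t \<omega> - N s \<omega>) \<in> measurable M (count_space UNIV)"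
  by (rule measurable_compose_countable[where f = "\<lambda>k \<omega>. N t \<omega> - k" and g = "N s"])
    (auto intro: measurable_compose[OF N_measurable] N_measurable)

lemma prob_increment:
  assumes "0 \<le> s" "s < t"
  shows "prob {\<omega> \<in> space M. N t \<omega> - N s \<omega> \<in> A} = measure (poisson_pmf (rate * (t - s))) A"
proof -
  have "measure (distr M (count_space UNIV) (\<lambda>\<omega>. N t \<omega> - N s \<omega>)) A
      = prob ((\<lambda>\<omega>. N t \<omega> - N s \<omega>) -` A \<inter> space M)"
    using assms by (intro measure_distr increment_measurable) auto
  then show ?thesis
    by (simp add: N_increments_poisson[OF assms] vimage_def Int_def conj_commute)
qed

text \<open>Used for the single last grid cell, where a bound linear in its length suffices.\<close>

lemma prob_increment_ge_1:
  assumes "0 \<le> s" "s < t"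
  shows "prob {\<omega> \<in> space M. 1 \<le> N t \<omega> - N s \<omega>} \<le> rate * (t - s)"
proof -
  define \<mu> where "\<mu> = rate * (t - s)"
  have \<mu>: "0 < \<mu>" using assms rate_pos by (simp add: \<mu>_def)
  have "prob {\<omega> \<in> space M. N t \<omega> - N s \<omega> \<in> - {0}} = measure (poisson_pmf \<mu>) (- {0})"
    unfolding \<mu>_def by (rule prob_increment[OF assms])
  also have "\<dots> = 1 - exp (- \<mu>)"
    using \<mu> measure_pmf.prob_compl[of "{0}" "poisson_pmf \<mu>"]
    by (simp add: Compl_eq_Diff_UNIV measure_pmf_single)
  also have "\<dots> \<le> \<mu>" using exp_ge_add_one_self[of "- \<mu>"] by simp
  also have "{\<omega> \<in> space M. N t \<omega> - N s \<omega> \<in> - {0}} = {\<omega> \<in> space M. 1 \<le> N t \<omega> - N s \<omega>}"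
    by auto
  finally show ?thesis by (simp add: \<mu>_def)
qed

text \<open>The quadratic order is essential: summed over about m cells of length of order 1/m, it
  still tends to 0.\<close>

lemma prob_increment_ge_2:
  assumes "0 \<le> s" "s < t"
  shows "prob {\<omega> \<in> space M. 2 \<le> N t \<omega> - N s \<omega>} \<le> (rate * (t - s))\<^sup>2"
proof -
  define \<mu> where "\<mu> = rate * (t - s)"
  have \<mu>: "0 < \<mu>" using assms rate_pos by (simp add: \<mu>_def)
  have "prob {\<omega> \<in> space M. N t \<omega> - N s \<omega> \<in> - {0, 1}} = measure (poisson_pmf \<mu>) (- {0, 1})"
    unfolding \<mu>_def by (rule prob_increment[OF assms])
  also have "\<dots> = 1 - (1 + \<mu>) * exp (- \<mu>)"
    using \<mu> measure_pmf.prob_compl[of "{0, 1}" "poisson_pmf \<mu>"]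
    by (simp add: Compl_eq_Diff_UNIV measure_measure_pmf_finite algebra_simps)
  also have "\<dots> \<le> 1 - (1 + \<mu>) * (1 - \<mu>)"
    using \<mu> exp_ge_add_one_self[of "- \<mu>"] by (intro diff_left_mono mult_left_mono) auto
  also have "\<dots> = \<mu>\<^sup>2" by (simp add: power2_eq_square algebra_simps)
  also have "{\<omega> \<in> space M. N t \<omega> - N s \<omega> \<in> - {0, 1}} = {\<omega> \<in> space M. 2 \<le> N t \<omega> - N s \<omega>}"
    by auto
  finally show ?thesis by (simp add: \<mu>_def)
qed

text \<open>If some value up to \<open>N t\<close> is not attained before t, the outcome lies in the
  bad event \<open>B m\<close> of every grid. Since \<open>prob (B m)\<close> is O(1/m), the
  intersection of these events is null.\<close>

lemma AE_all_values_attained: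
  assumes "0 < t"
  shows "AE \<omega> in M. \<forall>k\<le>N t \<omega>. \<exists>s\<in>{0..<t}. N s \<omega> = k"
proof -
  \<comment> \<open>With m + 1 cells, \<open>\<tau> m m\<close> is the last grid point before t, and
    \<open>\<tau> m (Suc m)\<close> is t itself.\<close>
  define \<tau> where "\<tau> m i = real i * t / real (Suc m)" for m i :: nat
  (* Outside B m no value is skipped on the grid, and the last increment vanishes; without the
     latter, N t might first be attained at time t itself, which is excluded here. *)
  define B where "B m = (\<Union>i<m. {\<omega> \<in> space M. 2 \<le> N (\<tau> m (Suc i)) \<omega> - N (\<tau> m i) \<omega>})
      \<union> {\<omega> \<in> space M. 1 \<le> N t \<omega> - N (\<tau> m m) \<omega>}" for m
  have \<tau>: "0 \<le> \<tau> m i" "\<tau> m i < \<tau> m (Suc i)" "\<tau> m (Suc i) - \<tau> m i = t / Suc m" for m i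
  proof -
    show diff: "\<tau> m (Suc i) - \<tau> m i = t / Suc m"
      unfolding \<tau>_def diff_divide_distrib[symmetric] by (simp add: algebra_simps)
    have "0 < t / Suc m" using assms by simp
    then show "\<tau> m i < \<tau> m (Suc i)" using diff by linarith
  qed (use assms in \<open>simp add: \<tau>_def\<close>)
  have \<tau>m: "\<tau> m m < t" "t - \<tau> m m = t / Suc m" for m
    using \<tau>(2,3)[of m m] by (simp_all add: \<tau>_def)
  have meas: "{\<omega> \<in> space M. j \<le> N v \<omega> - N u \<omega>} \<in> events" if "0 \<le> u" "0 \<le> v" for u v j
    using measurable_sets[OF increment_measurable[OF that], of "{j..}"]
    by (simp add: vimage_def Int_def conj_commute)
  have B: "B m \<in> events" for m
    unfolding B_def using \<tau>(1) assms by (intro sets.Un sets.finite_UN meas) auto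
  have small: "prob (B m) \<le> ((rate * t)\<^sup>2 + rate * t) * inverse (real (Suc m))" for m
  proof -
    have "prob (B m) \<le> (\<Sum>i<m. prob {\<omega> \<in> space M. 2 \<le> N (\<tau> m (Suc i)) \<omega> - N (\<tau> m i) \<omega>})
        + prob {\<omega> \<in> space M. 1 \<le> N t \<omega> - N (\<tau> m m) \<omega>}"
      unfolding B_def using \<tau>(1) assms
      by (intro order_trans[OF measure_Un_le] add_right_mono measure_UNION_le sets.finite_UN meas) auto
    also have "\<dots> \<le> (\<Sum>i<m. (rate * (t / Suc m))\<^sup>2) + rate * (t / Suc m)"
      using prob_increment_ge_2[OF \<tau>(1,2)] prob_increment_ge_1[OF \<tau>(1) \<tau>m(1)]
      unfolding \<tau>(3) \<tau>m(2) by (intro add_mono sum_mono) auto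
    \<comment> \<open>Enlarging the number of terms from m to \<open>Suc m\<close> lets one factor
      of the squared mesh cancel.\<close>
    also have "\<dots> \<le> real (Suc m) * (rate * (t / Suc m))\<^sup>2 + rate * (t / Suc m)"
      by (simp add: mult_right_mono)
    also have "\<dots> = ((rate * t)\<^sup>2 + rate * t) * inverse (real (Suc m))"
      by (simp add: power2_eq_square divide_simps)
    finally show ?thesis .
  qed
  have "prob (\<Inter>m. B m) \<le> 0"
  proof (rule LIMSEQ_le_const)
    show "(\<lambda>m. ((rate * t)\<^sup>2 + rate * t) * inverse (real (Suc m))) \<longlonglongrightarrow> 0"
      using tendsto_mult_right_zero[OF LIMSEQ_inverse_real_of_nat] .
    have "prob (\<Inter>m. B m) \<le> prob (B m)" for m
      using B by (intro finite_measure_mono) auto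
    then show "\<exists>n0. \<forall>m\<ge>n0. prob (\<Inter>m. B m) \<le> ((rate * t)\<^sup>2 + rate * t) * inverse (real (Suc m))"
      using small order_trans by blast
  qed
  then have "prob (\<Inter>m. B m) = 0" by (simp add: order_antisym)
  then have null: "(\<Inter>m. B m) \<in> null_sets M"
    using B by (intro null_setsI) (auto simp: emeasure_eq_measure)
  show ?thesis
  \<comment> \<open>The exceptional set involves uncountably many times; it only has to be contained
    in a null set.\<close>
  proof (rule AE_I'[OF null], rule subsetI)
    fix \<omega> assume "\<omega> \<in> {\<omega> \<in> space M. \<not> (\<forall>k\<le>N t \<omega>. \<exists>s\<in>{0..<t}. N s \<omega> = k)}"
    then obtain k where \<omega>: "\<omega> \<in> space M" and k: "k \<le> N t \<omega>" "\<And>s. s \<in> {0..<t} \<Longrightarrow> N s \<omega> \<noteq> k"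
      by auto
    show "\<omega> \<in> (\<Inter>m. B m)"
    proof (rule INT_I, rule ccontr)
      fix m assume "\<omega> \<notin> B m"
      then have B': "\<And>i. i < m \<Longrightarrow> N (\<tau> m (Suc i)) \<omega> \<le> Suc (N (\<tau> m i) \<omega>)" "N t \<omega> \<le> N (\<tau> m m) \<omega>"
        using \<omega> by (force simp: B_def)+
      have "\<exists>i\<le>m. N (\<tau> m i) \<omega> = k"
        using B' k(1) N_zero[OF \<omega>] by (intro grid_values_attained) (auto simp: \<tau>_def)
      then obtain i where i: "i \<le> m" "N (\<tau> m i) \<omega> = k" by auto
      have "\<tau> m i \<le> \<tau> m m" using i assms by (simp add: \<tau>_def divide_right_mono mult_right_mono)
      then show False using k(2)[of "\<tau> m i"] i \<tau>(1)[of m i] \<tau>m(1)[of m] by auto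
    qed
  qed
qed

end

section \<open>Measurability and almost sure form of the boundary event\<close>

context planar_motion
begin

lemma measurable_J0: "J0 \<in> measurable M (count_space UNIV)"
  and measurable_turn: "turn k \<in> measurable M (count_space UNIV)"
proof -
  have rv: "case_nat J0 turn i \<in> measurable M (count_space UNIV)" for i
    using turns_indep by (simp add: indep_vars_def2)
  show "J0 \<in> measurable M (count_space UNIV)" using rv[of 0] by simp
  show "turn k \<in> measurable M (count_space UNIV)" using rv[of "Suc k"] by simp
qed

lemma measurable_heading: "heading J0 turn n \<in> measurable M (count_space UNIV)"
proof (induction n)
  case 0
  then show ?case using measurable_J0 by (simp add: heading_def[abs_def])
next
  case (Suc n)
  have "heading J0 turn (Suc n) = (\<lambda>\<omega>. heading J0 turn n \<omega> + turn n \<omega>)"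
    by (simp add: heading_def fun_eq_iff)
  also have "\<dots> \<in> measurable M (count_space UNIV)"
    by (rule measurable_compose_countable[where f = "\<lambda>i \<omega>. i + turn n \<omega>" and g = "heading J0 turn n"])
      (auto intro: measurable_compose[OF measurable_turn] Suc)
  finally show ?case .
qed

text \<open>The values lie in a discrete space, where convergence means being eventually
  constant.\<close>

lemma N_eventually_constant:
  assumes "\<omega> \<in> space M" "0 \<le> s"
  shows "eventually (\<lambda>r. N r \<omega> = N s \<omega>) (at_right s)"
  using N_right_continuous[OF assms] by (simp add: continuous_within tendsto_discrete)

lemma position_mem_frontier_iff_heading:
  assumes "0 < c" "0 < t" "\<omega> \<in> space M"
  shows "position c N J0 turn t \<omega> \<in> frontier (square (c * t)) \<longleftrightarrow>
    (\<exists>a. \<forall>s\<in>{0..<t}. (heading J0 turn (N s \<omega>) \<omega> - a) mod 4 \<in> {0, 1})"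
  using assms N_mono[OF assms(3)] N_eventually_constant[OF assms(3)]
  by (intro position_mem_frontier_iff) (auto intro!: mono_onI)

text \<open>By right-constancy of the paths the condition at all times in \<open>{0..<t}\<close>
  reduces to rational times, and a ranges over the integers, so only countable operations
  remain.\<close>

lemma measurable_position_mem_frontier:
  assumes "0 < c" "0 < t"
  shows "{\<omega> \<in> space M. position c N J0 turn t \<omega> \<in> frontier (square (c * t))} \<in> events"
proof -
  define P where "P a s \<omega> \<longleftrightarrow> (heading J0 turn (N s \<omega>) \<omega> - a) mod 4 \<in> {0, 1}" for a s \<omega>
  have rational: "(\<forall>s\<in>{0..<t}. P a s \<omega>) \<longleftrightarrow> (\<forall>r::rat. of_rat r \<in> {0..<t} \<longrightarrow> P a (of_rat r) \<omega>)"
    if \<omega>: "\<omega> \<in> space M" for a \<omega>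
  proof
    assume *: "\<forall>r::rat. of_rat r \<in> {0..<t} \<longrightarrow> P a (of_rat r) \<omega>"
    show "\<forall>s\<in>{0..<t}. P a s \<omega>"
    proof
      fix s assume s: "s \<in> {0..<t}"
      then obtain b where b: "s < b" "\<And>r. s < r \<Longrightarrow> r < b \<Longrightarrow> N r \<omega> = N s \<omega>"
        using N_eventually_constant[OF \<omega>, of s] by (auto simp: eventually_at_right_field)
      \<comment> \<open>A rational time after s, before t and before N next changes has the same
        heading as s.\<close>
      obtain r :: rat where "s < of_rat r" "of_rat r < min b t"
        using of_rat_dense[of s "min b t"] s b(1) by auto
      then have "P a (of_rat r) \<omega>" "N (of_rat r) \<omega> = N s \<omega>"
        using s by (auto intro!: *[rule_format] b(2) simp del: zero_le_of_rat_iff)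
      then show "P a s \<omega>" by (simp add: P_def)
    qed
  qed auto
  have "{\<omega> \<in> space M. P a s \<omega>} \<in> events" if "0 \<le> s" for a s
  proof -
    have "(\<lambda>\<omega>. heading J0 turn (N s \<omega>) \<omega>) \<in> measurable M (count_space UNIV)"
      by (rule measurable_compose_countable[OF measurable_heading N_measurable[OF that]])
    then have "(\<lambda>\<omega>. heading J0 turn (N s \<omega>) \<omega>) -` {j. (j - a) mod 4 \<in> {0, 1}} \<inter> space M \<in> events"
      by (rule measurable_sets) auto
    then show ?thesis by (simp add: P_def vimage_def Int_def conj_commute)
  qed
  then have "{\<omega> \<in> space M. of_rat r \<in> {0..<t} \<longrightarrow> P a (of_rat r) \<omega>} \<in> events" for a and r :: rat
    by (cases "of_rat r \<in> {0..<t}") auto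
  then have "{\<omega> \<in> space M. \<exists>a. \<forall>r::rat. of_rat r \<in> {0..<t} \<longrightarrow> P a (of_rat r) \<omega>} \<in> events"
    by (intro sets.sets_Collect_countable_Ex sets.sets_Collect_countable_All)
  also have "{\<omega> \<in> space M. \<exists>a. \<forall>r::rat. of_rat r \<in> {0..<t} \<longrightarrow> P a (of_rat r) \<omega>}
      = {\<omega> \<in> space M. position c N J0 turn t \<omega> \<in> frontier (square (c * t))}"
    using position_mem_frontier_iff_heading[OF assms] rational by (auto simp: P_def)
  finally show ?thesis .
qed

text \<open>The three prescribed probabilities add up to 1, leaving no mass for other
  values.\<close>

lemma AE_turn: "AE \<omega> in M. \<forall>k. turn k \<omega> \<in> {1, - 1, 2}"
  unfolding AE_all_countable
proof
  fix k
  have ev: "{\<omega> \<in> space M. turn k \<omega> = i} \<in> events" for i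
    using measurable_sets[OF measurable_turn, of "{i}" k] by (simp add: vimage_def Int_def conj_commute)
  define T where "T i = {\<omega> \<in> space M. turn k \<omega> = i}" for i
  have T: "T i \<in> events" for i
    using ev by (simp add: T_def)
  have "prob (T 1 \<union> (T (- 1) \<union> T 2)) = prob (T 1) + prob (T (- 1) \<union> T 2)"
    using T by (intro finite_measure_Union) (auto simp: T_def)
  also have "prob (T (- 1) \<union> T 2) = prob (T (- 1)) + prob (T 2)"
    using T by (intro finite_measure_Union) (auto simp: T_def)
  finally have "prob (T 1 \<union> (T (- 1) \<union> T 2)) = 1"
    by (simp add: T_def turn_counterclockwise turn_clockwise turn_reflection)
  then have "AE \<omega> in M. \<omega> \<in> T 1 \<union> (T (- 1) \<union> T 2)"
    by (subst prob_eq_1[symmetric]) (auto intro!: sets.Un T)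
  then show "AE \<omega> in M. turn k \<omega> \<in> {1, - 1, 2}"
    by eventually_elim (auto simp: T_def)
qed

lemma AE_position_mem_frontier_iff:
  assumes "0 < c" "0 < t"
  shows "AE \<omega> in M. position c N J0 turn t \<omega> \<in> frontier (square (c * t)) \<longleftrightarrow>
    (\<exists>\<sigma>\<in>{1, - 1}. \<forall>k<N t \<omega>. turn k \<omega> = \<sigma> * (- 1) ^ k)"
  using AE_all_values_attained[OF \<open>0 < t\<close>] AE_turn AE_space
proof eventually_elim
  case (elim \<omega>)
  \<comment> \<open>By monotonicity and the absence of skipped values, N takes on
    \<open>{0..<t}\<close> exactly the values 0, ..., \<open>N t\<close>; this replaces times by
    event counts.\<close>
  have "(\<forall>s\<in>{0..<t}. P (N s \<omega>)) \<longleftrightarrow> (\<forall>k\<le>N t \<omega>. P k)" for P :: "nat \<Rightarrow> bool"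
    using elim(1) N_mono[OF elim(3)] by fastforce
  then have "(\<forall>s\<in>{0..<t}. (heading J0 turn (N s \<omega>) \<omega> - a) mod 4 \<in> {0, 1}) \<longleftrightarrow>
      (\<forall>k\<le>N t \<omega>. (J0 \<omega> + (\<Sum>k<k. turn k \<omega>) - a) mod 4 \<in> {0, 1})" for a
    unfolding heading_def .
  then show ?case
    unfolding position_mem_frontier_iff_heading[OF assms elim(3)]
    by (simp only: two_directions_iff_alternating[OF elim(2)[rule_format]])
qed

section \<open>Probability of alternating turns\<close>

lemma prob_turns:
  "prob {\<omega> \<in> space M. \<forall>k<n. turn k \<omega> = f k} = (\<Prod>k<n. prob {\<omega> \<in> space M. turn k \<omega> = f k})"
proof (cases "n = 0")
  case False
  \<comment> \<open>Index 0 of \<open>case_nat J0 turn\<close> is \<open>J0\<close>, so turn k sits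
    at index \<open>Suc k\<close>. The index set must be nonempty, hence the separate case n =
    0.\<close>
  have "prob (\<Inter>i\<in>Suc ` {..<n}. case_nat J0 turn i -` {f (i - 1)} \<inter> space M)
      = (\<Prod>i\<in>Suc ` {..<n}. prob (case_nat J0 turn i -` {f (i - 1)} \<inter> space M))"
    using False by (intro indep_varsD[OF turns_indep]) auto
  also have "(\<Inter>i\<in>Suc ` {..<n}. case_nat J0 turn i -` {f (i - 1)} \<inter> space M)
      = {\<omega> \<in> space M. \<forall>k<n. turn k \<omega> = f k}"
    using False by auto
  finally show ?thesis
    by (simp add: prod.reindex vimage_def Int_def conj_commute)
qed (simp add: prob_space)

text \<open>Independence from N is stated for generated sigma-algebras. A condition on several turns
  is not itself a generator, so closure under countable intersection places it there.\<close>

lemma turn_events_generated: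
  "{\<omega> \<in> space M. \<forall>k<n. turn k \<omega> = f k} \<in>
    sigma_sets (space M) {case_nat J0 turn k -` A \<inter> space M | k A. True}" (is "_ \<in> sigma_sets _ ?G")
proof -
  interpret G: sigma_algebra "space M" "sigma_sets (space M) ?G"
    by (rule sigma_algebra_sigma_sets) auto
  have eq: "{\<omega> \<in> space M. turn k \<omega> = f k} = case_nat J0 turn (Suc k) -` {f k} \<inter> space M" for k
    by (simp add: vimage_def Int_def conj_commute)
  have "{\<omega> \<in> space M. turn k \<omega> = f k} \<in> sigma_sets (space M) ?G" for k
    unfolding eq[of k] by (intro sigma_sets.Basic CollectI exI conjI) (rule refl TrueI)+
  then show ?thesis
    by (intro G.sets_Collect_countable_All G.sets_Collect_imp G.sets_Collect_const)
qed

lemma exists_alternating_generated: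
  "{\<omega> \<in> space M. \<exists>\<sigma>\<in>{1, - 1}. \<forall>k<n. turn k \<omega> = \<sigma> * (- 1) ^ k} \<in>
    sigma_sets (space M) {case_nat J0 turn k -` A \<inter> space M | k A. True}"
proof -
  have "{\<omega> \<in> space M. \<exists>\<sigma>\<in>{1, - 1}. \<forall>k<n. turn k \<omega> = \<sigma> * (- 1) ^ k}
      = {\<omega> \<in> space M. \<forall>k<n. turn k \<omega> = 1 * (- 1) ^ k}
      \<union> {\<omega> \<in> space M. \<forall>k<n. turn k \<omega> = - 1 * (- 1) ^ k}"
    by auto
  then show ?thesis
    by (simp only: sigma_sets_Un turn_events_generated)
qed

lemma turn_events: "{\<omega> \<in> space M. \<forall>k<n. turn k \<omega> = f k} \<in> events"
  by (rule subsetD[OF indep_setD_ev2[OF turns_indep_N] turn_events_generated])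

lemma prob_alternating:
  assumes "\<sigma> \<in> {1, - 1}"
  shows "prob {\<omega> \<in> space M. \<forall>k<n. turn k \<omega> = \<sigma> * (- 1) ^ k}
    = (\<Prod>k<n. if even k \<longleftrightarrow> \<sigma> = 1 then p else q)"
  unfolding prob_turns using assms
  by (intro prod.cong) (auto simp: turn_counterclockwise turn_clockwise)

text \<open>For n > 0 the two patterns already disagree at k = 0, so their probabilities add. For n
  = 0 both are the sure event, which would be counted twice; this is the subtracted 1.\<close>

lemma prob_exists_alternating:
  "prob {\<omega> \<in> space M. \<exists>\<sigma>\<in>{1, - 1}. \<forall>k<n. turn k \<omega> = \<sigma> * (- 1) ^ k}
    = (\<Prod>k<n. if even k then p else q) + (\<Prod>k<n. if even k then q else p) - (if n = 0 then 1 else 0)"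
proof (cases "n = 0")
  case False
  define A where "A \<sigma> = {\<omega> \<in> space M. \<forall>k<n. turn k \<omega> = \<sigma> * (- 1) ^ k}" for \<sigma>
  have "A \<sigma> \<in> events" for \<sigma>
    unfolding A_def by (rule turn_events)
  moreover have "A 1 \<inter> A (- 1) = {}" using False by (force simp: A_def)
  moreover have "{\<omega> \<in> space M. \<exists>\<sigma>\<in>{1, - 1}. \<forall>k<n. turn k \<omega> = \<sigma> * (- 1) ^ k} = A 1 \<union> A (- 1)"
    by (auto simp: A_def)
  ultimately have "prob {\<omega> \<in> space M. \<exists>\<sigma>\<in>{1, - 1}. \<forall>k<n. turn k \<omega> = \<sigma> * (- 1) ^ k}
      = prob (A 1) + prob (A (- 1))"
    by (simp only: finite_measure_Union)
  also have "prob (A 1) = (\<Prod>k<n. if even k then p else q)"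
    unfolding A_def by (subst prob_alternating) (auto intro!: prod.cong)
  also have "prob (A (- 1)) = (\<Prod>k<n. if even k then q else p)"
    unfolding A_def by (subst prob_alternating) (auto intro!: prod.cong)
  finally show ?thesis using False by simp
next
  case True
  then have "{\<omega> \<in> space M. \<exists>\<sigma>\<in>{1, - 1}. \<forall>k<n. turn k \<omega> = \<sigma> * (- 1) ^ k} = space M"
    by blast
  then show ?thesis using True by (simp add: prob_space)
qed

section \<open>Averaging over the number of events\<close>

lemma prob_N_eq:
  assumes "0 < t"
  shows "prob {\<omega> \<in> space M. N t \<omega> = n} = (rate * t) ^ n / fact n * exp (- (rate * t))"
proof -
  have "{\<omega> \<in> space M. N t \<omega> = n} = {\<omega> \<in> space M. N t \<omega> - N 0 \<omega> \<in> {n}}"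
    using N_zero by auto
  also have "prob \<dots> = pmf (poisson_pmf (rate * t)) n"
    using prob_increment[of 0 t "{n}"] assms by (simp add: measure_pmf_single)
  finally show ?thesis using assms rate_pos by simp
qed

text \<open>With the count frozen at n, the condition on the turns no longer involves N, so
  independence of the two sigma-algebras factorises the probability.\<close>

lemma prob_N_eq_and_alternating:
  assumes "0 < t"
  shows "prob {\<omega> \<in> space M. N t \<omega> = n \<and> (\<exists>\<sigma>\<in>{1, - 1}. \<forall>k<n. turn k \<omega> = \<sigma> * (- 1) ^ k)}
    = (rate * t) ^ n / fact n * exp (- (rate * t)) *
      ((\<Prod>k<n. if even k then p else q) + (\<Prod>k<n. if even k then q else p) - (if n = 0 then 1 else 0))"
proof -
  define A where "A = {\<omega> \<in> space M. \<exists>\<sigma>\<in>{1, - 1}. \<forall>k<n. turn k \<omega> = \<sigma> * (- 1) ^ k}"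
  have "A \<in> sigma_sets (space M) {case_nat J0 turn k -` A \<inter> space M | k A. True}"
    unfolding A_def by (rule exists_alternating_generated)
  moreover have "{\<omega> \<in> space M. N t \<omega> = n} \<in> {N t -` A \<inter> space M | t A. 0 \<le> t}"
    using assms by (intro CollectI exI[of _ t] exI[of _ "{n}"]) auto
  ultimately have "prob ({\<omega> \<in> space M. N t \<omega> = n} \<inter> A) = prob {\<omega> \<in> space M. N t \<omega> = n} * prob A"
    by (intro indep_setD[OF turns_indep_N] sigma_sets.Basic[of "{\<omega> \<in> space M. N t \<omega> = n}"])
  also have "{\<omega> \<in> space M. N t \<omega> = n} \<inter> A
      = {\<omega> \<in> space M. N t \<omega> = n \<and> (\<exists>\<sigma>\<in>{1, - 1}. \<forall>k<n. turn k \<omega> = \<sigma> * (- 1) ^ k)}"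
    by (auto simp: A_def)
  finally show ?thesis
    by (simp only: prob_N_eq[OF assms] A_def prob_exists_alternating)
qed

text \<open>Up to a null set the boundary event is the disjoint union over n of the events
  \<open>A n\<close>, so its probability is the sum of the Poisson series.\<close>

lemma prob_position_mem_frontier:
  assumes "0 < c" "0 < t" "0 < p" "0 < q"
  shows "prob {\<omega> \<in> space M. position c N J0 turn t \<omega> \<in> frontier (square (c * t))}
    = exp (- (rate * t)) *
      (exp (rate * t * sqrt (p * q)) * (1 + (p + q) / (2 * sqrt (p * q)))
       + exp (- (rate * t) * sqrt (p * q)) * (1 - (p + q) / (2 * sqrt (p * q))) - 1)"
proof -
  define A where "A n = {\<omega> \<in> space M. N t \<omega> = n \<and> (\<exists>\<sigma>\<in>{1, - 1}. \<forall>k<n. turn k \<omega> = \<sigma> * (- 1) ^ k)}" for n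
  have A: "A n \<in> events" for n
  proof -
    have "{\<omega> \<in> space M. \<exists>\<sigma>\<in>{1, - 1}. \<forall>k<n. turn k \<omega> = \<sigma> * (- 1) ^ k} \<in> events"
      by (rule subsetD[OF indep_setD_ev2[OF turns_indep_N] exists_alternating_generated])
    moreover have "{\<omega> \<in> space M. N t \<omega> = n} \<in> events"
      using measurable_sets[OF N_measurable, of t "{n}"] assms(2)
      by (simp add: vimage_def Int_def conj_commute)
    ultimately show ?thesis
      unfolding A_def by (rule sets.sets_Collect_conj)
  qed
  have "prob {\<omega> \<in> space M. position c N J0 turn t \<omega> \<in> frontier (square (c * t))} = prob (\<Union>n. A n)"
  proof (rule finite_measure_eq_AE)
    show "AE \<omega> in M. \<omega> \<in> {\<omega> \<in> space M. position c N J0 turn t \<omega> \<in> frontier (square (c * t))}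
        \<longleftrightarrow> \<omega> \<in> (\<Union>n. A n)"
      using AE_position_mem_frontier_iff[OF assms(1,2)] AE_space
      by eventually_elim (auto simp: A_def)
  qed (use A measurable_position_mem_frontier[OF assms(1,2)] in auto)
  also have "prob (\<Union>n. A n) = exp (- (rate * t)) *
      (exp (rate * t * sqrt (p * q)) * (1 + (p + q) / (2 * sqrt (p * q)))
       + exp (- (rate * t) * sqrt (p * q)) * (1 - (p + q) / (2 * sqrt (p * q))) - 1)"
  proof (rule sums_unique2)
    show "(\<lambda>n. prob (A n)) sums prob (\<Union>n. A n)"
      using A by (intro finite_measure_UNION) (auto simp: disjoint_family_on_def A_def)
    show "(\<lambda>n. prob (A n)) sums (exp (- (rate * t)) *
        (exp (rate * t * sqrt (p * q)) * (1 + (p + q) / (2 * sqrt (p * q)))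
         + exp (- (rate * t) * sqrt (p * q)) * (1 - (p + q) / (2 * sqrt (p * q))) - 1))"
      unfolding A_def prob_N_eq_and_alternating[OF assms(2)]
      by (rule alternating_poisson_sums) (use assms rate_pos in simp_all)
  qed
  finally show ?thesis .
qed

end

theorem theorem1:
  fixes M :: "'a measure" and lam c p q t :: real
    and N :: "real \<Rightarrow> 'a \<Rightarrow> nat" and J0 :: "'a \<Rightarrow> int" and turn :: "nat \<Rightarrow> 'a \<Rightarrow> int"
  assumes "lam > 0" and "c > 0" and "p > 0" and "q > 0" and "p + q \<le> 1"
    and "planar_motion M lam N p q J0 turn"
    and "t > 0"
  shows "measure M {\<omega> \<in> space M. position c N J0 turn t \<omega> \<in> frontier (square (c * t))}
    = exp (- lam * t) *
      (exp (lam * t * sqrt (p * q)) * (1 + (p + q) / (2 * sqrt (p * q)))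
       + exp (- lam * t * sqrt (p * q)) * (1 - (p + q) / (2 * sqrt (p * q)))
       - 1)"
  using planar_motion.prob_position_mem_frontier[OF assms(6,2,7,3,4)] by simp

end
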